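(* Let $n\ge 1$ and $d\ge 0$ be integers, and let $K=K(n,d)$ be a natural number such that for any reduced Stein space $X$ of finite complex dimension $d$, every null-homotopic holomorphic map $X\to SL_n(\mathbb{C})$ can be written as a product of no more than $K$ unitriangular matrices with entries in $\mathcal{O}(X)$. Then for any reduced Stein space $X$ of finite complex dimension $d$, every null-homotopic holomorphic map $f: X\to SL_n(\mathbb{C})$ can be written as a product of no more than $4\left(\lfloor K/2\rfloor+1\right)$ involutions with entries in $\mathcal{O}(X)$.
   Context: $\mathcal{O}(X)$ is the ring of holomorphic functions on $X$; holomorphic maps $X\to SL_n(\mathbb{C})$ are identified with elements of $SL_n(\mathcal{O}(X))$. A unitriangular matrix is an upper or a lower triangular matrix with all diagonal entries equal to $1$. An involution with entries in $\mathcal{O}(X)$ is a matrix $B\in GL_n(\mathcal{O}(X))$ with $B^2=I$. Null-homotopic means homotopic to a constant map through continuous maps $X\to SL_n(\mathbb{C})$. A natural number $K(n,d)$ with the stated property exists for all $n$ and $d$ by a theorem of Ivarsson and Kutzschebauch. *)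

theory Defs
  imports "HOL-Analysis.Analysis"
begin

text \<open>
  The dimension \<open>m\<close> of the ambient space of a local model varies with the model, so the number of
  coordinates cannot be a type: the space of \<open>m\<close> complex variables is realised as the set of
  sequences vanishing from index \<open>m\<close> on, with the subspace topology of the product topology.
\<close>

definition cspace :: "nat \<Rightarrow> (nat \<Rightarrow> complex) set" where
  "cspace m = {z. \<forall>i\<ge>m. z i = 0}"

abbreviation open_in_cspace :: "nat \<Rightarrow> (nat \<Rightarrow> complex) set \<Rightarrow> bool" where
  "open_in_cspace m D \<equiv> openin (top_of_set (cspace m)) D"

text \<open>
  Holomorphy of a function on an open \<open>D\<close> in the space of \<open>m\<close> complex variables: at every point
  there is a complex-linear approximation with error \<open>o(\<parallel>w - z\<parallel>)\<close>; the norm used is the sum of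
  the moduli of the coordinates.
\<close>

definition holomorphic_multi ::
    "nat \<Rightarrow> (nat \<Rightarrow> complex) set \<Rightarrow> ((nat \<Rightarrow> complex) \<Rightarrow> complex) \<Rightarrow> bool" where
  "holomorphic_multi m D F \<longleftrightarrow>
     (\<forall>z\<in>D. \<exists>a :: nat \<Rightarrow> complex.
        ((\<lambda>w. (F w - F z - (\<Sum>i<m. a i * (w i - z i))) /
              complex_of_real (\<Sum>i<m. cmod (w i - z i))) \<longlongrightarrow> 0) (at z within D))"

definition analytic_subset ::
    "nat \<Rightarrow> (nat \<Rightarrow> complex) set \<Rightarrow> (nat \<Rightarrow> complex) set \<Rightarrow> bool" where
  "analytic_subset m D A \<longleftrightarrow>
     A \<subseteq> D \<and>
     (\<forall>z\<in>D. \<exists>W G. open_in_cspace m W \<and> z \<in> W \<and> W \<subseteq> D \<and> finite G \<and>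
        (\<forall>F\<in>G. holomorphic_multi m W F) \<and> A \<inter> W = {w \<in> W. \<forall>F\<in>G. F w = 0})"

text \<open>
  The sections over \<open>V\<close> (open in \<open>A\<close>) of the reduced structure sheaf of an analytic set \<open>A\<close>:
  functions that are locally restrictions of holomorphic functions of the ambient space.
\<close>

definition model_sections ::
    "nat \<Rightarrow> (nat \<Rightarrow> complex) set \<Rightarrow> (nat \<Rightarrow> complex) set \<Rightarrow> ((nat \<Rightarrow> complex) \<Rightarrow> complex) set" where
  "model_sections m A V =
     {h. \<forall>z\<in>V. \<exists>W F. open_in_cspace m W \<and> z \<in> W \<and> holomorphic_multi m W F \<and>
           A \<inter> W \<subseteq> V \<and> (\<forall>w \<in> A \<inter> W. h w = F w)}"

text \<open>
  A sheaf of complex algebras of continuous functions. Sections over \<open>U\<close> are total functions of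
  which only the values on \<open>U\<close> matter (second condition), so restriction of sections is the
  identity on functions; the last two conditions are restriction and gluing.
\<close>

definition function_sheaf :: "'a topology \<Rightarrow> ('a set \<Rightarrow> ('a \<Rightarrow> complex) set) \<Rightarrow> bool" where
  "function_sheaf X \<O> \<longleftrightarrow>
     (\<forall>U. openin X U \<longrightarrow>
        (\<forall>f\<in>\<O> U. continuous_map (subtopology X U) euclidean f) \<and>
        (\<forall>f\<in>\<O> U. \<forall>g. (\<forall>x\<in>U. g x = f x) \<longrightarrow> g \<in> \<O> U) \<and>
        (\<forall>c. (\<lambda>_. c) \<in> \<O> U) \<and>
        (\<forall>f\<in>\<O> U. \<forall>g\<in>\<O> U. (\<lambda>x. f x + g x) \<in> \<O> U \<and> (\<lambda>x. f x * g x) \<in> \<O> U) \<and>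
        (\<forall>f\<in>\<O> U. \<forall>V. openin X V \<and> V \<subseteq> U \<longrightarrow> f \<in> \<O> V) \<and>
        (\<forall>f. (\<forall>x\<in>U. \<exists>V. openin X V \<and> x \<in> V \<and> V \<subseteq> U \<and> f \<in> \<O> V) \<longrightarrow> f \<in> \<O> U))"

text \<open>
  \<open>(\<phi>, \<psi>)\<close> is an isomorphism of ringed spaces, with inverse, from the open subset \<open>U\<close> of \<open>X\<close>
  onto the analytic subset \<open>A\<close> of the open set \<open>D\<close>.
\<close>

definition chart ::
    "'a topology \<Rightarrow> ('a set \<Rightarrow> ('a \<Rightarrow> complex) set) \<Rightarrow> 'a set \<Rightarrow> nat \<Rightarrow>
     (nat \<Rightarrow> complex) set \<Rightarrow> (nat \<Rightarrow> complex) set \<Rightarrow>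
     ('a \<Rightarrow> nat \<Rightarrow> complex) \<Rightarrow> ((nat \<Rightarrow> complex) \<Rightarrow> 'a) \<Rightarrow> bool" where
  "chart X \<O> U m D A \<phi> \<psi> \<longleftrightarrow>
     openin X U \<and> open_in_cspace m D \<and> analytic_subset m D A \<and>
     homeomorphic_maps (subtopology X U) (top_of_set A) \<phi> \<psi> \<and>
     (\<forall>V g. openin X V \<and> V \<subseteq> U \<longrightarrow>
        (g \<in> \<O> V \<longleftrightarrow> g \<circ> \<psi> \<in> model_sections m A (\<phi> ` V)))"

text \<open>
  Reduced complex spaces are Hausdorff with countable topology. Being reduced is built in: the
  structure sheaf consists of functions.
\<close>

definition reduced_complex_space ::
    "'a topology \<Rightarrow> ('a set \<Rightarrow> ('a \<Rightarrow> complex) set) \<Rightarrow> bool" where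
  "reduced_complex_space X \<O> \<longleftrightarrow>
     Hausdorff_space X \<and> second_countable X \<and> function_sheaf X \<O> \<and>
     (\<forall>x\<in>topspace X. \<exists>U m D A \<phi> \<psi>. x \<in> U \<and> chart X \<O> U m D A \<phi> \<psi>)"

text \<open>
  The bound \<open>c\<close> replaces the supremum of \<open>\<bar>f\<bar>\<close> over \<open>K\<close>, so that the hull of the empty set is
  empty.
\<close>

definition holomorphic_hull ::
    "'a topology \<Rightarrow> ('a set \<Rightarrow> ('a \<Rightarrow> complex) set) \<Rightarrow> 'a set \<Rightarrow> 'a set" where
  "holomorphic_hull X \<O> K =
     {x \<in> topspace X. \<forall>f\<in>\<O> (topspace X). \<forall>c::real.
        (\<forall>y\<in>K. cmod (f y) \<le> c) \<longrightarrow> cmod (f x) \<le> c}"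

definition reduced_stein_space ::
    "'a topology \<Rightarrow> ('a set \<Rightarrow> ('a \<Rightarrow> complex) set) \<Rightarrow> bool" where
  "reduced_stein_space X \<O> \<longleftrightarrow>
     reduced_complex_space X \<O> \<and>
     (\<forall>K. compactin X K \<longrightarrow> compactin X (holomorphic_hull X \<O> K)) \<and>
     (\<forall>x\<in>topspace X. \<forall>y\<in>topspace X. x \<noteq> y \<longrightarrow> (\<exists>f\<in>\<O> (topspace X). f x \<noteq> f y))"

text \<open>
  A point is regular of dimension \<open>k\<close> if a neighbourhood is isomorphic to an open subset of
  \<open>k\<close>-dimensional complex space (a chart with \<open>A = D\<close>). The dimension of a reduced space is the
  supremum of the dimensions of its regular points (which are dense); the following says that
  this supremum is finite and equal to \<open>d\<close>.
\<close>

definition regular_point ::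
    "'a topology \<Rightarrow> ('a set \<Rightarrow> ('a \<Rightarrow> complex) set) \<Rightarrow> nat \<Rightarrow> 'a \<Rightarrow> bool" where
  "regular_point X \<O> k x \<longleftrightarrow> (\<exists>U D \<phi> \<psi>. x \<in> U \<and> chart X \<O> U k D D \<phi> \<psi>)"

definition has_complex_dimension ::
    "'a topology \<Rightarrow> ('a set \<Rightarrow> ('a \<Rightarrow> complex) set) \<Rightarrow> nat \<Rightarrow> bool" where
  "has_complex_dimension X \<O> d \<longleftrightarrow>
     (\<exists>x\<in>topspace X. regular_point X \<O> d x) \<and>
     (\<forall>x\<in>topspace X. \<forall>k. regular_point X \<O> k x \<longrightarrow> k \<le> d)"

text \<open>
  Matrices over the ring of global holomorphic functions are matrix-valued functions on \<open>X\<close> with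
  holomorphic entries; as for sections, only the values on \<open>topspace X\<close> matter, and all matrix
  identities are required there. Matrices are indexed by a finite linearly ordered type, the
  order being needed for triangularity.
\<close>

definition holomorphic_entries ::
    "'a topology \<Rightarrow> ('a set \<Rightarrow> ('a \<Rightarrow> complex) set) \<Rightarrow> ('a \<Rightarrow> complex^'n^'n) \<Rightarrow> bool" where
  "holomorphic_entries X \<O> M \<longleftrightarrow> (\<forall>i j. (\<lambda>x. M x $ i $ j) \<in> \<O> (topspace X))"

definition SL_set :: "(complex^'n^'n) set" where
  "SL_set = {A. det A = 1}"

definition holomorphic_SL_map ::
    "'a topology \<Rightarrow> ('a set \<Rightarrow> ('a \<Rightarrow> complex) set) \<Rightarrow> ('a \<Rightarrow> complex^'n^'n) \<Rightarrow> bool" where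
  "holomorphic_SL_map X \<O> f \<longleftrightarrow>
     holomorphic_entries X \<O> f \<and> (\<forall>x\<in>topspace X. f x \<in> SL_set)"

definition null_homotopic_SL :: "'a topology \<Rightarrow> ('a \<Rightarrow> complex^'n^'n) \<Rightarrow> bool" where
  "null_homotopic_SL X f \<longleftrightarrow>
     (\<exists>A\<in>SL_set. homotopic_with (\<lambda>_. True) X (top_of_set SL_set) f (\<lambda>_. A))"

definition unitriangular_entries ::
    "'a topology \<Rightarrow> ('a set \<Rightarrow> ('a \<Rightarrow> complex) set) \<Rightarrow>
     ('a \<Rightarrow> complex^('n::{finite,linorder})^('n::{finite,linorder})) \<Rightarrow> bool" where
  "unitriangular_entries X \<O> M \<longleftrightarrow>
     holomorphic_entries X \<O> M \<and>
     (\<forall>x\<in>topspace X. \<forall>i. M x $ i $ i = 1) \<and>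
     ((\<forall>x\<in>topspace X. \<forall>i j. j < i \<longrightarrow> M x $ i $ j = 0) \<or>
      (\<forall>x\<in>topspace X. \<forall>i j. i < j \<longrightarrow> M x $ i $ j = 0))"

text \<open>Invertibility over the ring is automatic: such a \<open>B\<close> is its own inverse.\<close>

definition involution_entries ::
    "'a topology \<Rightarrow> ('a set \<Rightarrow> ('a \<Rightarrow> complex) set) \<Rightarrow> ('a \<Rightarrow> complex^'n^'n) \<Rightarrow> bool" where
  "involution_entries X \<O> B \<longleftrightarrow>
     holomorphic_entries X \<O> B \<and> (\<forall>x\<in>topspace X. B x ** B x = mat 1)"

text \<open>The empty product, allowed here, is the identity matrix.\<close>

definition product_of_at_most ::
    "'a topology \<Rightarrow> (('a \<Rightarrow> complex^'n^'n) \<Rightarrow> bool) \<Rightarrow> nat \<Rightarrow> ('a \<Rightarrow> complex^'n^'n) \<Rightarrow> bool" where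
  "product_of_at_most X P N f \<longleftrightarrow>
     (\<exists>Ms. length Ms \<le> N \<and> (\<forall>M\<in>set Ms. P M) \<and>
        (\<forall>x\<in>topspace X. f x = foldr (\<lambda>M B. M x ** B) Ms (mat 1)))"

end

theory Submission
  imports Defs
begin

text \<open>
  Let \<open>D\<close> be a constant diagonal matrix whose diagonal entries are distinct and are permuted by
  \<open>z \<mapsto> 1/z\<close>. A triangular holomorphic matrix with the diagonal of \<open>D\<close> is conjugate to \<open>D\<close> over the
  ring of holomorphic functions, because solving for the eigenvectors only requires division by
  the nonzero constants \<open>d\<^sub>j - d\<^sub>i\<close>. Moreover \<open>D = (D P) P\<close> for the permutation matrix \<open>P\<close> of the
  inversion, and both factors are involutions. Splitting a product of two unitriangular matrices
  as \<open>M N = (M D\<^sup>-\<^sup>1) (D N)\<close> therefore exhibits it as a product of four involutions.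
\<close>

section \<open>Triangular matrices with distinct diagonal entries\<close>

definition diag_matrix :: "('n \<Rightarrow> complex) \<Rightarrow> complex^'n^'n" where
  "diag_matrix d = (\<chi> i j. if i = j then d i else 0)"

lemma matrix_mult_diag_matrix:
  "(A ** diag_matrix d) $ i $ j = A $ i $ j * d j"
  by (simp add: matrix_matrix_mult_def diag_matrix_def if_distrib cong: if_cong)

lemma diag_matrix_mult:
  "(diag_matrix d ** A) $ i $ j = d i * A $ i $ j"
  by (simp add: matrix_matrix_mult_def diag_matrix_def if_distrib if_distribR cong: if_cong)

text \<open>The order of the indices enters as a rank function, so that lower and upper triangular
  matrices are one notion; reversing the ranks exchanges them.\<close>

definition triangular_wrt :: "('n \<Rightarrow> nat) \<Rightarrow> complex^'n^'n \<Rightarrow> bool" where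
  "triangular_wrt h A \<longleftrightarrow> (\<forall>i j. h i < h j \<longrightarrow> A $ i $ j = 0)"

text \<open>Forward substitution for the eigenvector with eigenvalue \<open>d j\<close> normalised at \<open>j\<close>.\<close>

function eigenvector ::
    "('n::finite \<Rightarrow> nat) \<Rightarrow> ('n \<Rightarrow> complex) \<Rightarrow> complex^'n^'n \<Rightarrow> 'n \<Rightarrow> 'n \<Rightarrow> complex" where
  "eigenvector h d A j i =
     (if i = j then 1
      else (\<Sum>k | h k < h i. A $ i $ k * eigenvector h d A j k) * inverse (d j - d i))"
  by auto
termination
  by (relation "Wellfounded.measure (\<lambda>(h, d, A, j, i). h i)") auto

declare eigenvector.simps [simp del]

lemma eigenvector_self [simp]: "eigenvector h d A j j = 1"
  by (simp add: eigenvector.simps)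

text \<open>The normalising 1 enters only at \<open>j\<close>, and each other entry is a combination
  of entries of lower rank, so below the rank of \<open>j\<close> there is nothing but 0 to
  propagate.\<close>

lemma eigenvector_eq_0:
  "h i < h j \<Longrightarrow> eigenvector h d A j i = 0"
proof (induction "h i" arbitrary: i rule: less_induct)
  case less
  then have "i \<noteq> j"
    by auto
  moreover have "eigenvector h d A j k = 0" if "h k < h i" for k
    using less that by (meson less_trans)
  ultimately show ?case
    by (subst eigenvector.simps) simp
qed

definition eigenmatrix :: "('n::finite \<Rightarrow> nat) \<Rightarrow> ('n \<Rightarrow> complex) \<Rightarrow> complex^'n^'n \<Rightarrow> complex^'n^'n"
  where "eigenmatrix h d A = (\<chi> i j. eigenvector h d A j i)"

lemma triangular_eigenmatrix: "triangular_wrt h (eigenmatrix h d A)"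
  by (simp add: triangular_wrt_def eigenmatrix_def eigenvector_eq_0)

lemma eigenmatrix_diag [simp]: "eigenmatrix h d A $ i $ i = 1"
  by (simp add: eigenmatrix_def)

text \<open>At an entry with \<open>i\<close> \<noteq> \<open>j\<close> the equation is the
  recursion multiplied by the nonzero \<open>d j - d i\<close>; at \<open>i = j\<close> the
  off-diagonal terms vanish, since column \<open>j\<close> is 0 below the rank of
  \<open>j\<close>.\<close>

lemma triangular_mult_eigenmatrix:
  fixes A :: "complex^'n::finite^'n"
  assumes "inj h" and "inj d" and tri: "triangular_wrt h A" and diag: "\<And>i. A $ i $ i = d i"
  shows "A ** eigenmatrix h d A = eigenmatrix h d A ** diag_matrix d"
proof -
  have "(\<Sum>k\<in>UNIV. A $ i $ k * eigenvector h d A j k) = eigenvector h d A j i * d j" for i j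
  proof -
    let ?v = "eigenvector h d A j"
    let ?s = "\<Sum>k | h k < h i. A $ i $ k * ?v k"
    have "(\<Sum>k\<in>UNIV. A $ i $ k * ?v k) = (\<Sum>k\<in>insert i {k. h k < h i}. A $ i $ k * ?v k)"
    \<comment> \<open>By injectivity of \<open>h\<close>, the omitted indices have rank above
      \<open>h i\<close>, where row \<open>i\<close> of \<open>A\<close> vanishes.\<close>
    proof (rule sum.mono_neutral_right)
      show "\<forall>k \<in> UNIV - insert i {k. h k < h i}. A $ i $ k * ?v k = 0"
        using tri \<open>inj h\<close> unfolding triangular_wrt_def
        by (auto dest: injD simp: not_less le_less)
    qed auto
    also have "\<dots> = d i * ?v i + ?s"
      using diag by simp
    also have "\<dots> = ?v i * d j"
    proof (cases "i = j")
      case True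
      then have "?s = 0"
        by (intro sum.neutral) (auto simp: eigenvector_eq_0)
      with True show ?thesis
        by simp
    next
      case False
      then have "d j - d i \<noteq> 0"
        using \<open>inj d\<close> by (auto dest: injD)
      moreover have "?v i = ?s * inverse (d j - d i)"
        using False by (subst eigenvector.simps) simp
      ultimately have "?v i * (d j - d i) = ?s"
        by simp
      then show ?thesis
        by (simp add: algebra_simps)
    qed
    finally show ?thesis .
  qed
  then show ?thesis
    by (simp add: vec_eq_iff matrix_mult_diag_matrix)
       (simp add: matrix_matrix_mult_def eigenmatrix_def)
qed

text \<open>
  The inverse of the eigenvector matrix is obtained from the eigenvectors of the transpose, so
  that its entries are visibly polynomial in those of \<open>A\<close>: the product of the two matrices
  commutes with \<open>diag_matrix d\<close> and is therefore diagonal.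
\<close>

lemma eigenmatrix_transpose_inverse:
  fixes A :: "complex^'n::finite^'n"
  assumes "inj h" and "inj h'" and rev: "\<And>i j. h' i < h' j \<longleftrightarrow> h j < h i"
    and "inj d" and tri: "triangular_wrt h A" and diag: "\<And>i. A $ i $ i = d i"
  defines "V \<equiv> eigenmatrix h d A"
    and "W \<equiv> transpose (eigenmatrix h' d (transpose A))"
  shows "W ** V = mat 1" and "V ** W = mat 1" and "A = V ** diag_matrix d ** W"
proof -
  have AV: "A ** V = V ** diag_matrix d"
    unfolding V_def using assms by (intro triangular_mult_eigenmatrix) auto
  \<comment> \<open>\<open>transpose A\<close> is triangular for the reversed ranks
    \<open>h'\<close> and has the same diagonal; its eigenvectors are the left eigenvectors of
    \<open>A\<close>.\<close>
  have "transpose A ** transpose W = transpose W ** diag_matrix d"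
    unfolding W_def transpose_transpose using assms
    by (intro triangular_mult_eigenmatrix) (auto simp: triangular_wrt_def transpose_def)
  then have "transpose (transpose A ** transpose W) = transpose (transpose W ** diag_matrix d)"
    by simp
  moreover have "transpose (diag_matrix d) = diag_matrix d"
    by (auto simp: diag_matrix_def transpose_def vec_eq_iff)
  ultimately have WA: "W ** A = diag_matrix d ** W"
    by (simp add: matrix_transpose_mul)
  have comm: "(W ** V) ** diag_matrix d = diag_matrix d ** (W ** V)"
    by (metis AV WA matrix_mul_assoc)
  have "(W ** V) $ i $ j = 0" if "i \<noteq> j" for i j
  proof -
    have "(W ** V) $ i $ j * d j = d i * (W ** V) $ i $ j"
      using comm by (metis matrix_mult_diag_matrix diag_matrix_mult)
    moreover have "d i \<noteq> d j"
      using that \<open>inj d\<close> by (auto dest: injD)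
    ultimately show ?thesis
      by (simp add: mult.commute)
  qed
  \<comment> \<open>\<open>W\<close> and \<open>V\<close> are triangular for the same ranks
    \<open>h\<close>, with unit diagonal, so only the term \<open>k = i\<close> survives.\<close>
  moreover have "(W ** V) $ i $ i = 1" for i
  proof -
    have W0: "W $ i $ k = 0" if "h i < h k" for k
      using triangular_eigenmatrix [of h' d "transpose A"] that rev
      by (simp add: W_def triangular_wrt_def transpose_def)
    have V0: "V $ k $ i = 0" if "h k < h i" for k
      using triangular_eigenmatrix [of h d A] that by (simp add: V_def triangular_wrt_def)
    have "(W ** V) $ i $ i = (\<Sum>k\<in>UNIV. W $ i $ k * V $ k $ i)"
      by (simp add: matrix_matrix_mult_def)
    also have "\<dots> = (\<Sum>k\<in>{i}. W $ i $ k * V $ k $ i)"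
    proof (rule sum.mono_neutral_right)
      show "\<forall>k\<in>UNIV - {i}. W $ i $ k * V $ k $ i = 0"
        using W0 V0 \<open>inj h\<close> by (metis DiffD2 injD insertCI linorder_neqE_nat mult_eq_0_iff)
    qed auto
    finally show ?thesis
      by (simp add: W_def V_def transpose_def)
  qed
  ultimately show WV: "W ** V = mat 1"
    by (simp add: vec_eq_iff mat_def)
  then show VW: "V ** W = mat 1"
    by (simp add: matrix_left_right_inverse)
  show "A = V ** diag_matrix d ** W"
    by (metis AV VW matrix_mul_assoc matrix_mul_rid)
qed

section \<open>Diagonal matrices as products of two involutions\<close>

definition perm_matrix :: "('n \<Rightarrow> 'n) \<Rightarrow> complex^'n^'n" where
  "perm_matrix p = (\<chi> i j. if j = p i then 1 else 0)"

lemma matrix_mult_perm_matrix: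
  fixes A :: "complex^'n::finite^'m"
  assumes "\<And>i. p (p i) = i"
  shows "(A ** perm_matrix p) $ i $ j = A $ i $ p j"
proof -
  have "j = p k \<longleftrightarrow> k = p j" for k
    using assms by metis
  then show ?thesis
    by (simp add: matrix_matrix_mult_def perm_matrix_def if_distrib cong: if_cong)
qed

text \<open>The nonzero entries of \<open>D ** P ** D\<close> are the
  \<open>d i * d (p i) = 1\<close> at position \<open>(i, p i)\<close>. Hence
  \<open>D ** P ** D = P\<close>, and \<open>D ** P\<close> squares to
  \<open>P ** P = mat 1\<close>.\<close>

lemma diag_matrix_eq_involutions:
  fixes d :: "'n::finite \<Rightarrow> complex"
  assumes p: "\<And>i. p (p i) = i" and d: "\<And>i. d i * d (p i) = 1"
  obtains S T where "S ** S = mat 1" "T ** T = mat 1" "diag_matrix d = S ** T"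
proof -
  let ?P = "perm_matrix p"
  let ?D = "diag_matrix d"
  have eq: "p i = p j \<longleftrightarrow> i = j" "p i = j \<longleftrightarrow> i = p j" for i j
    using p by metis+
  have PP: "?P ** ?P = mat 1"
    by (simp add: vec_eq_iff matrix_mult_perm_matrix [OF p] mat_def)
       (auto simp: perm_matrix_def eq p)
  have "(?D ** ?P ** ?D) $ i $ j = ?P $ i $ j" for i j
    using d by (auto simp: matrix_mult_diag_matrix diag_matrix_mult perm_matrix_def)
  then have "?D ** ?P ** ?D = ?P"
    by (simp add: vec_eq_iff)
  then have "(?D ** ?P) ** (?D ** ?P) = mat 1"
    using PP by (simp add: matrix_mul_assoc)
  moreover have "?D = (?D ** ?P) ** ?P"
    using PP by (simp flip: matrix_mul_assoc)
  ultimately show thesis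
    using PP that by blast
qed

text \<open>
  The exponents \<open>2 e\<^sub>i - (n - 1)\<close>, with \<open>e\<^sub>i\<close> running through \<open>0, \<dots>, n - 1\<close>, are distinct and
  symmetric about \<open>0\<close>.
\<close>

lemma ex_distinct_inversion_symmetric:
  obtains d :: "'n::finite \<Rightarrow> complex" and p :: "'n \<Rightarrow> 'n"
  where "inj d" "\<And>i. p (p i) = i" "\<And>i. d i * d (p i) = 1"
proof -
  let ?n = "CARD('n)"
  obtain e :: "'n \<Rightarrow> nat" where e: "bij_betw e UNIV {0..<?n}"
    using ex_bij_betw_finite_nat [OF finite] by blast
  have lt: "e i < ?n" for i
    using e by (auto simp: bij_betw_def)
  \<comment> \<open>Reflecting the numbering, e to n - 1 - e, negates the exponents.\<close>
  define p where "p i = inv e (?n - 1 - e i)" for i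
  have ep: "e (p i) = ?n - 1 - e i" for i
    unfolding p_def using e lt [of i] by (intro f_inv_into_f) (auto simp: bij_betw_def)
  have "inj e"
    using e by (simp add: bij_betw_def)
  \<comment> \<open>The real exponential is used because it is injective; this makes the entries
    distinct.\<close>
  define d :: "'n \<Rightarrow> complex"
    where "d i = of_real (exp (2 * real (e i) - (real ?n - 1)))" for i
  show thesis
  proof
    show "inj d"
      using \<open>inj e\<close> by (auto simp: d_def inj_def)
    show "p (p i) = i" for i
    proof -
      have "e (p (p i)) = e i"
        using lt [of i] by (simp add: ep)
      with \<open>inj e\<close> show ?thesis
        by (auto dest: injD)
    qed
    show "d i * d (p i) = 1" for i
    proof -
      have "real (e (p i)) = real ?n - 1 - real (e i)"
        using lt [of i] by (simp add: ep of_nat_diff)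
      then show ?thesis
        by (simp add: d_def flip: of_real_mult exp_add)
    qed
  qed
qed

section \<open>Matrices of holomorphic functions\<close>

context
  fixes X :: "'a topology" and \<O> :: "'a set \<Rightarrow> ('a \<Rightarrow> complex) set"
  assumes sheaf: "function_sheaf X \<O>"
begin

lemma global_sections:
  shows const_global_section: "(\<lambda>_. c) \<in> \<O> (topspace X)"
    and add_global_section:
      "f \<in> \<O> (topspace X) \<Longrightarrow> g \<in> \<O> (topspace X) \<Longrightarrow> (\<lambda>x. f x + g x) \<in> \<O> (topspace X)"
    and mult_global_section:
      "f \<in> \<O> (topspace X) \<Longrightarrow> g \<in> \<O> (topspace X) \<Longrightarrow> (\<lambda>x. f x * g x) \<in> \<O> (topspace X)"
proof -
  note * = sheaf [unfolded function_sheaf_def, THEN spec, THEN mp, OF openin_topspace,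
      THEN conjunct2, THEN conjunct2]
  show "(\<lambda>_. c) \<in> \<O> (topspace X)"
    using * [THEN conjunct1] by (rule spec)
  show "(\<lambda>x. f x + g x) \<in> \<O> (topspace X)" "(\<lambda>x. f x * g x) \<in> \<O> (topspace X)"
    if "f \<in> \<O> (topspace X)" "g \<in> \<O> (topspace X)"
    using * [THEN conjunct2, THEN conjunct1] that by blast+
qed

lemma sum_global_section:
  assumes "\<And>i. i \<in> I \<Longrightarrow> f i \<in> \<O> (topspace X)"
  shows "(\<lambda>x. \<Sum>i\<in>I. f i x) \<in> \<O> (topspace X)"
  using assms
  \<comment> \<open>A sum over an infinite index set is 0 by convention, again a constant
    section.\<close>
  by (induction I rule: infinite_finite_induct)
     (auto intro: const_global_section add_global_section)

lemma holomorphic_entries_const: "holomorphic_entries X \<O> (\<lambda>_. A)"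
  by (simp add: holomorphic_entries_def const_global_section)

lemma holomorphic_entries_mult:
  "holomorphic_entries X \<O> M \<Longrightarrow> holomorphic_entries X \<O> N
    \<Longrightarrow> holomorphic_entries X \<O> (\<lambda>x. M x ** N x)"
  by (simp add: holomorphic_entries_def matrix_matrix_mult_def
      sum_global_section mult_global_section)

lemma holomorphic_entries_transpose:
  "holomorphic_entries X \<O> M \<Longrightarrow> holomorphic_entries X \<O> (\<lambda>x. transpose (M x))"
  by (simp add: holomorphic_entries_def transpose_def)

text \<open>Along the recursion, by induction on the rank, only sums, products and the constants
  \<open>inverse (d j - d i)\<close> occur; no holomorphic function is ever inverted.\<close>

lemma holomorphic_entries_eigenmatrix:
  assumes M: "holomorphic_entries X \<O> M"
  shows "holomorphic_entries X \<O> (\<lambda>x. eigenmatrix h d (M x))"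
proof -
  have "(\<lambda>x. eigenvector h d (M x) j i) \<in> \<O> (topspace X)" for i j
  proof (induction "h i" arbitrary: i rule: less_induct)
    case less
    show ?case
    proof (cases "i = j")
      case True
      then show ?thesis
        by (simp add: const_global_section)
    next
      case False
      have "(\<lambda>x. (\<Sum>k | h k < h i. M x $ i $ k * eigenvector h d (M x) j k) * inverse (d j - d i))
          \<in> \<O> (topspace X)"
        using M less
        by (intro mult_global_section sum_global_section const_global_section)
           (auto simp: holomorphic_entries_def)
      with False show ?thesis
        by (subst eigenvector.simps) simp
    qed
  qed
  then show ?thesis
    by (simp add: holomorphic_entries_def eigenmatrix_def)
qed

text \<open>The constant factorisation \<open>diag_matrix d = S ** T\<close> is conjugated by the
  eigenvector matrix \<open>V\<close>, whose inverse \<open>W\<close> is holomorphic as well. The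
  factors are \<open>V ** S ** W\<close> and \<open>V ** T ** W\<close>.\<close>

lemma triangular_eq_involutions:
  fixes M :: "'a \<Rightarrow> complex^'n::finite^'n" and h h' :: "'n \<Rightarrow> nat"
  assumes M: "holomorphic_entries X \<O> M"
    and ranks: "inj h" "inj h'" "\<And>i j. h' i < h' j \<longleftrightarrow> h j < h i"
    and tri: "\<And>x. x \<in> topspace X \<Longrightarrow> triangular_wrt h (M x)"
    and diag: "\<And>x i. x \<in> topspace X \<Longrightarrow> M x $ i $ i = d i"
    and d: "inj d" "\<And>i. p (p i) = i" "\<And>i. d i * d (p i) = 1"
  obtains B C where "involution_entries X \<O> B" "involution_entries X \<O> C"
    "\<And>x. x \<in> topspace X \<Longrightarrow> M x = B x ** C x"
proof -
  define V where "V x = eigenmatrix h d (M x)" for x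
  define W where "W x = transpose (eigenmatrix h' d (transpose (M x)))" for x
  have hol: "holomorphic_entries X \<O> V" "holomorphic_entries X \<O> W"
    unfolding V_def W_def
    by (intro holomorphic_entries_transpose holomorphic_entries_eigenmatrix M)+
  have WV: "W x ** V x = mat 1" and VW: "V x ** W x = mat 1"
    and conj: "M x = V x ** diag_matrix d ** W x" if "x \<in> topspace X" for x
    using eigenmatrix_transpose_inverse [OF ranks d(1) tri diag, OF that that]
    unfolding V_def W_def by blast+
  obtain S T where ST: "S ** S = mat 1" "T ** T = mat 1" "diag_matrix d = S ** T"
    using diag_matrix_eq_involutions [where p = p and d = d, OF d(2,3)] by blast
  have mult: "(V x ** S' ** W x) ** (V x ** T' ** W x) = V x ** (S' ** T') ** W x"
    if "x \<in> topspace X" for x S' T'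
  proof -
    have "(V x ** S' ** W x) ** (V x ** T' ** W x) = V x ** S' ** (W x ** V x) ** T' ** W x"
      by (simp add: matrix_mul_assoc)
    then show ?thesis
      using WV [OF that] by (simp add: matrix_mul_assoc)
  qed
  have inv: "involution_entries X \<O> (\<lambda>x. V x ** S' ** W x)" if "S' ** S' = mat 1" for S'
    using that hol mult VW
    by (simp add: involution_entries_def holomorphic_entries_mult holomorphic_entries_const)
  show thesis
    using that [OF inv inv, OF ST(1,2)] mult conj ST(3) by simp
qed

section \<open>Products of unitriangular matrices\<close>

lemma unitriangular_mult_eq_involutions:
  fixes M N :: "'a \<Rightarrow> complex^('n::{finite,linorder})^('n::{finite,linorder})"
  assumes M: "unitriangular_entries X \<O> M" and N: "unitriangular_entries X \<O> N"
  obtains B C E F where "involution_entries X \<O> B" "involution_entries X \<O> C"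
    "involution_entries X \<O> E" "involution_entries X \<O> F"
    "\<And>x. x \<in> topspace X \<Longrightarrow> M x ** N x = B x ** (C x ** (E x ** F x))"
proof -
  obtain d :: "'n \<Rightarrow> complex" and p where d: "inj d" "\<And>i. p (p i) = i" "\<And>i. d i * d (p i) = 1"
    using ex_distinct_inversion_symmetric by blast
  let ?d' = "\<lambda>i. inverse (d i)"
  have d0: "d i \<noteq> 0" for i
    using d(3) [of i] by auto
  \<comment> \<open>The inverted diagonal has the same symmetry under the same \<open>p\<close>, so
    the factor carrying it splits in the same way.\<close>
  have d': "inj ?d'" "\<And>i. p (p i) = i" "\<And>i. ?d' i * ?d' (p i) = 1"
    using d by (auto simp: inj_def simp flip: inverse_mult_distrib)
  \<comment> \<open>\<open>l\<close> ranks the indices in their order and \<open>u\<close> in the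
    reverse order: triangular with respect to \<open>l\<close> means lower triangular, with respect
    to \<open>u\<close> upper triangular.\<close>
  define l :: "'n \<Rightarrow> nat" where "l i = card {..<i}" for i
  define u :: "'n \<Rightarrow> nat" where "u i = card {i<..}" for i
  have l: "l i < l j" if "i < j" for i j
    unfolding l_def using that by (intro psubset_card_mono) auto
  have u: "u j < u i" if "i < j" for i j
    unfolding u_def using that by (intro psubset_card_mono) auto
  have l_iff: "l i < l j \<longleftrightarrow> i < j" and u_iff: "u i < u j \<longleftrightarrow> j < i" for i j
    using l u by (metis less_asym less_irrefl linorder_neqE)+
  have "inj l" "inj u"
    using l u by (metis injI less_irrefl linorder_neqE)+
  \<comment> \<open>\<open>M\<close> and \<open>N\<close> may be triangular of different kinds, so
    each receives its own rank function together with the reversed one.\<close>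
  have ranks: "\<exists>h h' :: 'n \<Rightarrow> nat. inj h \<and> inj h' \<and> (\<forall>i j. h' i < h' j \<longleftrightarrow> h j < h i) \<and>
      (\<forall>x\<in>topspace X. triangular_wrt h (L x))"
    if L: "unitriangular_entries X \<O> L" for L :: "'a \<Rightarrow> complex^('n::{finite,linorder})^('n::{finite,linorder})"
  proof -
    consider "\<forall>x\<in>topspace X. triangular_wrt l (L x)" | "\<forall>x\<in>topspace X. triangular_wrt u (L x)"
      using L unfolding unitriangular_entries_def triangular_wrt_def l_iff u_iff by blast
    then show ?thesis
    proof cases
      case 1
      with \<open>inj l\<close> \<open>inj u\<close> show ?thesis
        by - (rule exI [of _ l], rule exI [of _ u], simp add: l_iff u_iff)
    next
      case 2
      with \<open>inj l\<close> \<open>inj u\<close> show ?thesis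
        by - (rule exI [of _ u], rule exI [of _ l], simp add: l_iff u_iff)
    qed
  qed
  obtain h h' :: "'n \<Rightarrow> nat" where h: "inj h" "inj h'" "\<And>i j. h' i < h' j \<longleftrightarrow> h j < h i"
      and trih: "\<And>x. x \<in> topspace X \<Longrightarrow> triangular_wrt h (M x)"
    using ranks [OF M] by metis
  obtain k k' :: "'n \<Rightarrow> nat" where k: "inj k" "inj k'" "\<And>i j. k' i < k' j \<longleftrightarrow> k j < k i"
      and trik: "\<And>x. x \<in> topspace X \<Longrightarrow> triangular_wrt k (N x)"
    using ranks [OF N] by metis
  let ?M = "\<lambda>x. M x ** diag_matrix ?d'"
  let ?N = "\<lambda>x. diag_matrix d ** N x"
  have hol: "holomorphic_entries X \<O> ?M" "holomorphic_entries X \<O> ?N"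
    using M N by (auto simp: unitriangular_entries_def
        intro: holomorphic_entries_mult holomorphic_entries_const)
  have tri: "triangular_wrt h (?M x)" "triangular_wrt k (?N x)" if "x \<in> topspace X" for x
    using trih [OF that] trik [OF that]
    by (auto simp: triangular_wrt_def matrix_mult_diag_matrix diag_matrix_mult)
  have diag: "?M x $ i $ i = ?d' i" "?N x $ i $ i = d i" if "x \<in> topspace X" for x i
    using M N that
    by (auto simp: unitriangular_entries_def matrix_mult_diag_matrix diag_matrix_mult)
  obtain B C where BC: "involution_entries X \<O> B" "involution_entries X \<O> C"
    "\<And>x. x \<in> topspace X \<Longrightarrow> ?M x = B x ** C x"
    using triangular_eq_involutions [OF hol(1) h tri(1) diag(1) d'] by blast
  obtain E F where EF: "involution_entries X \<O> E" "involution_entries X \<O> F"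
    "\<And>x. x \<in> topspace X \<Longrightarrow> ?N x = E x ** F x"
    using triangular_eq_involutions [OF hol(2) k tri(2) diag(2) d] by blast
  have dd: "diag_matrix ?d' ** diag_matrix d = mat 1"
    using d0 by (simp add: vec_eq_iff matrix_mult_diag_matrix) (simp add: diag_matrix_def mat_def)
  have "M x ** N x = B x ** (C x ** (E x ** F x))" if "x \<in> topspace X" for x
  proof -
    have "M x ** N x = M x ** (diag_matrix ?d' ** diag_matrix d) ** N x"
      by (simp add: dd)
    also have "\<dots> = ?M x ** ?N x"
      by (simp add: matrix_mul_assoc)
    finally show ?thesis
      using BC(3) [OF that] EF(3) [OF that] by (simp add: matrix_mul_assoc)
  qed
  with BC(1,2) EF(1,2) show thesis
    using that by blast
qed

text \<open>The factors are grouped in consecutive pairs, each giving four involutions; an odd last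
  factor is paired with the identity, so the number of pairs is half the length, rounded up.\<close>

lemma unitriangular_product_eq_involutions:
  fixes Ms :: "('a \<Rightarrow> complex^('n::{finite,linorder})^('n::{finite,linorder})) list"
  assumes "\<forall>M\<in>set Ms. unitriangular_entries X \<O> M"
  shows "product_of_at_most X (involution_entries X \<O>) (4 * ((length Ms + 1) div 2))
    (\<lambda>x. foldr (\<lambda>M B. M x ** B) Ms (mat 1))"
  using assms
proof (induction Ms rule: induct_list012)
  case 1
  show ?case
    unfolding product_of_at_most_def by (intro exI [of _ "[]"]) auto
next
  case (2 M)
  have "unitriangular_entries X \<O> (\<lambda>_. mat 1 :: complex^('n::{finite,linorder})^('n::{finite,linorder}))"
    by (auto simp: unitriangular_entries_def holomorphic_entries_const mat_def)
  moreover have "unitriangular_entries X \<O> M"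
    using 2 by simp
  ultimately obtain B C E F where *: "involution_entries X \<O> B" "involution_entries X \<O> C"
    "involution_entries X \<O> E" "involution_entries X \<O> F"
    "\<And>x. x \<in> topspace X \<Longrightarrow> M x ** mat 1 = B x ** (C x ** (E x ** F x))"
    using unitriangular_mult_eq_involutions by blast
  then show ?case
    unfolding product_of_at_most_def by (intro exI [of _ "[B, C, E, F]"]) auto
next
  case (3 M N Ms)
  then have "unitriangular_entries X \<O> M" "unitriangular_entries X \<O> N"
    by simp_all
  then obtain B C E F where *: "involution_entries X \<O> B" "involution_entries X \<O> C"
    "involution_entries X \<O> E" "involution_entries X \<O> F"
    "\<And>x. x \<in> topspace X \<Longrightarrow> M x ** N x = B x ** (C x ** (E x ** F x))"
    using unitriangular_mult_eq_involutions by blast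
  obtain Bs where Bs: "length Bs \<le> 4 * ((length Ms + 1) div 2)"
    "\<forall>B\<in>set Bs. involution_entries X \<O> B"
    "\<forall>x\<in>topspace X. foldr (\<lambda>M B. M x ** B) Ms (mat 1) = foldr (\<lambda>M B. M x ** B) Bs (mat 1)"
    using 3 unfolding product_of_at_most_def by auto
  show ?case
    unfolding product_of_at_most_def
  proof (intro exI [of _ "B # C # E # F # Bs"] conjI ballI)
    fix x assume x: "x \<in> topspace X"
    then show "foldr (\<lambda>M B. M x ** B) (M # N # Ms) (mat 1)
        = foldr (\<lambda>M B. M x ** B) (B # C # E # F # Bs) (mat 1)"
      using *(5) [OF x] Bs(3) by (simp add: matrix_mul_assoc)
  qed (use * Bs in auto)
qed

end

theorem corollary3p5:
  fixes d K :: nat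
  assumes "\<And>(X :: 'a topology) \<O> (f :: 'a \<Rightarrow> complex^('n::{finite,linorder})^('n::{finite,linorder})).
      \<lbrakk>reduced_stein_space X \<O>; has_complex_dimension X \<O> d;
       holomorphic_SL_map X \<O> f; null_homotopic_SL X f\<rbrakk>
      \<Longrightarrow> product_of_at_most X (unitriangular_entries X \<O>) K f"
  shows "\<And>(X :: 'a topology) \<O> (f :: 'a \<Rightarrow> complex^('n::{finite,linorder})^('n::{finite,linorder})).
      \<lbrakk>reduced_stein_space X \<O>; has_complex_dimension X \<O> d;
       holomorphic_SL_map X \<O> f; null_homotopic_SL X f\<rbrakk>
      \<Longrightarrow> product_of_at_most X (involution_entries X \<O>) (4 * (K div 2 + 1)) f"
proof -
  fix X :: "'a topology" and \<O> and f :: "'a \<Rightarrow> complex^('n::{finite,linorder})^('n::{finite,linorder})"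
  assume stein: "reduced_stein_space X \<O>" and "has_complex_dimension X \<O> d"
    "holomorphic_SL_map X \<O> f" "null_homotopic_SL X f"
  then have "product_of_at_most X (unitriangular_entries X \<O>) K f"
    by (rule assms)
  then obtain Ms where Ms: "length Ms \<le> K" "\<forall>M\<in>set Ms. unitriangular_entries X \<O> M"
    "\<forall>x\<in>topspace X. f x = foldr (\<lambda>M B. M x ** B) Ms (mat 1)"
    unfolding product_of_at_most_def by blast
  have "function_sheaf X \<O>"
    using stein by (simp add: reduced_stein_space_def reduced_complex_space_def)
  from unitriangular_product_eq_involutions [OF this Ms(2)]
  obtain Bs where Bs: "length Bs \<le> 4 * ((length Ms + 1) div 2)"
    "\<forall>B\<in>set Bs. involution_entries X \<O> B"
    "\<forall>x\<in>topspace X. foldr (\<lambda>M B. M x ** B) Ms (mat 1) = foldr (\<lambda>M B. M x ** B) Bs (mat 1)"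
    unfolding product_of_at_most_def by blast
  \<comment> \<open>Half of the length rounded up is at most \<open>K div 2 + 1\<close>, with
    equality if the length is \<open>K\<close> and \<open>K\<close> is odd.\<close>
  have "(length Ms + 1) div 2 \<le> K div 2 + 1"
    using Ms(1) by linarith
  with Bs(1) have "length Bs \<le> 4 * (K div 2 + 1)"
    by (meson le_trans mult_le_mono2)
  with Bs(2,3) Ms(3) show "product_of_at_most X (involution_entries X \<O>) (4 * (K div 2 + 1)) f"
    unfolding product_of_at_most_def by (intro exI [of _ Bs]) auto
qed

end
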